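(* Let $(J,\mathcal{B})$ be a sigma-algebra and let $\varphi:\mathcal{B}\to\mathbb{R}$ be an increasing submodular setfunction that is continuous from above. Then the pseudometric $d(X,Y)=2\varphi(X\cup Y)-\varphi(X)-\varphi(Y)$ on $\mathcal{B}$ is complete: every Cauchy sequence $X_1,X_2,\dots$ in $(\mathcal{B},d)$ has some $Z\in\mathcal{B}$ with $d(X_n,Z)\to0$.
   Context: Submodular: $\varphi(S\cup T)+\varphi(S\cap T)\le\varphi(S)+\varphi(T)$. Continuous from above: for every $A_1\supseteq A_2\supseteq\cdots$ in $\mathcal{B}$ with $A=\bigcap_iA_i$, $\varphi(A_n)\to\varphi(A)$. For increasing submodular $\varphi$, $d$ (the Björner distance) is a pseudometric on $\mathcal{B}$. *)

theory Defs
  imports "HOL-Analysis.Analysis"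
begin

definition submodular :: "'a set set \<Rightarrow> ('a set \<Rightarrow> real) \<Rightarrow> bool" where
  "submodular B \<phi> \<longleftrightarrow>
     (\<forall>S\<in>B. \<forall>T\<in>B. \<phi> (S \<union> T) + \<phi> (S \<inter> T) \<le> \<phi> S + \<phi> T)"

definition continuous_from_above :: "'a set set \<Rightarrow> ('a set \<Rightarrow> real) \<Rightarrow> bool" where
  "continuous_from_above B \<phi> \<longleftrightarrow>
     (\<forall>A. range A \<subseteq> B \<longrightarrow> decseq A \<longrightarrow>
        (\<lambda>n. \<phi> (A n)) \<longlonglongrightarrow> \<phi> (\<Inter>i. A i))"

definition bjorner_dist :: "('a set \<Rightarrow> real) \<Rightarrow> 'a set \<Rightarrow> 'a set \<Rightarrow> real" where
  "bjorner_dist \<phi> X Y = 2 * \<phi> (X \<union> Y) - \<phi> X - \<phi> Y"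

text \<open>Distinct points of a pseudometric may have distance zero, so the library's
  metric space notions do not apply.\<close>

definition pseudometric_on :: "'b set \<Rightarrow> ('b \<Rightarrow> 'b \<Rightarrow> real) \<Rightarrow> bool" where
  "pseudometric_on S d \<longleftrightarrow>
     (\<forall>x\<in>S. d x x = 0) \<and>
     (\<forall>x\<in>S. \<forall>y\<in>S. 0 \<le> d x y) \<and>
     (\<forall>x\<in>S. \<forall>y\<in>S. d x y = d y x) \<and>
     (\<forall>x\<in>S. \<forall>y\<in>S. \<forall>z\<in>S. d x z \<le> d x y + d y z)"

definition pm_Cauchy :: "'b set \<Rightarrow> ('b \<Rightarrow> 'b \<Rightarrow> real) \<Rightarrow> (nat \<Rightarrow> 'b) \<Rightarrow> bool" where
  "pm_Cauchy S d X \<longleftrightarrow>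
     range X \<subseteq> S \<and> (\<forall>\<epsilon>>0. \<exists>N. \<forall>m\<ge>N. \<forall>n\<ge>N. d (X m) (X n) < \<epsilon>)"

definition pm_complete :: "'b set \<Rightarrow> ('b \<Rightarrow> 'b \<Rightarrow> real) \<Rightarrow> bool" where
  "pm_complete S d \<longleftrightarrow>
     (\<forall>X. pm_Cauchy S d X \<longrightarrow> (\<exists>z\<in>S. (\<lambda>n. d (X n) z) \<longlonglongrightarrow> 0))"

lemma pseudometric_on_bjorner_dist:
  assumes "sigma_algebra J B" and inc: "increasing B \<phi>" and sub: "submodular B \<phi>"
  shows "pseudometric_on B (bjorner_dist \<phi>)"
proof -
  interpret sigma_algebra J B by fact
  have mono: "\<phi> X \<le> \<phi> Y" if "X \<in> B" "Y \<in> B" "X \<subseteq> Y" for X Y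
    using increasingD[OF inc] that by blast
  have nonneg: "0 \<le> bjorner_dist \<phi> X Y" if "X \<in> B" "Y \<in> B" for X Y
    using mono[of X "X \<union> Y"] mono[of Y "X \<union> Y"] that Un[of X Y] by (simp add: bjorner_dist_def)
  have tri: "bjorner_dist \<phi> X Z \<le> bjorner_dist \<phi> X Y + bjorner_dist \<phi> Y Z"
    if "X \<in> B" "Y \<in> B" "Z \<in> B" for X Y Z
  proof -
    have "\<phi> ((X \<union> Y) \<union> (Y \<union> Z)) + \<phi> ((X \<union> Y) \<inter> (Y \<union> Z)) \<le> \<phi> (X \<union> Y) + \<phi> (Y \<union> Z)"
      using sub Un[OF that(1,2)] Un[OF that(2,3)] unfolding submodular_def by blast
    moreover have "\<phi> (X \<union> Z) \<le> \<phi> ((X \<union> Y) \<union> (Y \<union> Z))"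
      by (rule mono) (use that in auto)
    moreover have "\<phi> Y \<le> \<phi> ((X \<union> Y) \<inter> (Y \<union> Z))"
      by (rule mono) (use that in auto)
    ultimately show ?thesis
      by (simp add: bjorner_dist_def)
  qed
  show ?thesis
    unfolding pseudometric_on_def
    using nonneg tri by (auto simp: bjorner_dist_def Un_commute)
qed

end

theory Submission
  imports Defs
begin

text \<open>Submodularity bounds the increment \<open>\<phi> A - \<phi> (A n)\<close> by \<open>\<phi> (A - A n) - \<phi> {}\<close>, so continuity
  from above at the empty set forces continuity from below. Given a Cauchy sequence, pass to a
  subsequence \<open>Y\<close> with \<open>d (Y k) (Y (k + 1)) < 2 ^ (- k)\<close>. By submodularity, adjoining \<open>Y (m + 1)\<close> to
  \<open>Y k \<union> \<dots> \<union> Y m\<close> raises \<open>\<phi>\<close> by at most \<open>d (Y m) (Y (m + 1))\<close>; by continuity from below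
  the tail unions \<open>U k = Y k \<union> Y (k + 1) \<union> \<dots>\<close> then satisfy \<open>\<phi> (U k) \<le> \<phi> (Y k) + 2 * 2 ^ (- k)\<close>.
  The limit is \<open>Z = limsup Y = \<Inter>k. U k\<close>: since \<open>\<phi> (U k) \<longlonglongrightarrow> \<phi> Z\<close> and both \<open>Y k\<close> and \<open>Z\<close>
  are contained in \<open>U k\<close>, the distance \<open>d (Y k) Z\<close> tends to zero.\<close>

lemma submodular_continuous_from_below:
  assumes "sigma_algebra J B" and inc: "increasing B \<phi>" and sub: "submodular B \<phi>"
    and cont: "continuous_from_above B \<phi>"
    and A: "range A \<subseteq> B" "incseq A"
  shows "(\<lambda>n. \<phi> (A n)) \<longlonglongrightarrow> \<phi> (\<Union>i. A i)"
proof -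
  interpret sigma_algebra J B by fact
  define U where "U = (\<Union>i. A i)"
  have AB: "A n \<in> B" for n
    using A by auto
  have UB: "U \<in> B"
    unfolding U_def using A(1) by (rule countable_UN)
  have "(\<lambda>n. \<phi> (U - A n)) \<longlonglongrightarrow> \<phi> (\<Inter>n. U - A n)"
  proof -
    have "range (\<lambda>n. U - A n) \<subseteq> B"
      using UB AB by auto
    moreover have "decseq (\<lambda>n. U - A n)"
      using \<open>incseq A\<close> by (auto simp: monotone_def)
    ultimately show ?thesis
      using cont unfolding continuous_from_above_def by blast
  qed
  also have "(\<Inter>n. U - A n) = {}"
    by (auto simp: U_def)
  \<comment> \<open>The value \<phi> {} is carried along because \<phi> need not vanish at the empty
    set; it cancels in the limit.\<close>
  finally have "(\<lambda>n. \<phi> U + \<phi> {} - \<phi> (U - A n)) \<longlonglongrightarrow> \<phi> U + \<phi> {} - \<phi> {}"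
    by (intro tendsto_intros)
  then have lower: "(\<lambda>n. \<phi> U + \<phi> {} - \<phi> (U - A n)) \<longlonglongrightarrow> \<phi> U"
    by simp
  have "\<phi> U + \<phi> {} - \<phi> (U - A n) \<le> \<phi> (A n)" for n
  proof -
    have "A n \<union> (U - A n) = U" "A n \<inter> (U - A n) = {}"
      by (auto simp: U_def)
    moreover have "\<phi> (A n \<union> (U - A n)) + \<phi> (A n \<inter> (U - A n)) \<le> \<phi> (A n) + \<phi> (U - A n)"
      using sub AB UB unfolding submodular_def by blast
    ultimately show ?thesis by simp
  qed
  moreover have "\<phi> (A n) \<le> \<phi> U" for n
    by (rule increasingD[OF inc]) (use AB UB in \<open>auto simp: U_def\<close>)
  ultimately have "(\<lambda>n. \<phi> (A n)) \<longlonglongrightarrow> \<phi> U"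
    by (intro tendsto_sandwich[OF _ _ lower tendsto_const] always_eventually allI)
  then show ?thesis
    by (simp add: U_def)
qed

text \<open>Induction on \<open>m\<close>: submodularity is applied to the union so far and
  \<open>Y m \<union> Y (Suc m)\<close>. These overlap in a superset of \<open>Y m\<close>, so
  \<phi> grows by at most \<open>\<phi> (Y m \<union> Y (Suc m)) - \<phi> (Y m)\<close>.\<close>

lemma submodular_UN_le_sum_bjorner_dist:
  assumes "sigma_algebra J B" and inc: "increasing B \<phi>" and sub: "submodular B \<phi>"
    and Y: "range Y \<subseteq> B"
  shows "\<phi> (\<Union>i\<le>m. Y i) \<le> \<phi> (Y 0) + (\<Sum>i<m. bjorner_dist \<phi> (Y i) (Y (Suc i)))"
proof (induction m)
  case 0
  then show ?case by simp
next
  case (Suc m)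
  interpret sigma_algebra J B by fact
  have YB: "Y i \<in> B" for i
    using Y by auto
  let ?S = "\<Union>i\<le>m. Y i" and ?T = "Y m \<union> Y (Suc m)"
  have SB: "?S \<in> B"
    using YB by (intro finite_UN) auto
  have "\<phi> (?S \<union> ?T) + \<phi> (?S \<inter> ?T) \<le> \<phi> ?S + \<phi> ?T"
    using sub SB YB unfolding submodular_def by blast
  moreover have "?S \<union> ?T = (\<Union>i\<le>Suc m. Y i)"
    by (auto simp: atMost_Suc)
  moreover have "\<phi> (Y m) \<le> \<phi> (?S \<inter> ?T)"
    by (rule increasingD[OF inc]) (use SB YB in auto)
  \<comment> \<open>The distance is \<open>(\<phi> ?T - \<phi> (Y m)) + (\<phi> ?T - \<phi> (Y (Suc
    m)))\<close>. The first summand is the increment to be bounded; this makes the second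
    nonnegative.\<close>
  moreover have "\<phi> (Y (Suc m)) \<le> \<phi> ?T"
    by (rule increasingD[OF inc]) (use YB in auto)
  ultimately show ?case
    using Suc.IH by (simp add: bjorner_dist_def)
qed

text \<open>The previous bound, applied to the sequence shifted by \<open>k\<close>, is uniform in
  \<open>m\<close> by a geometric series, so it survives the limit given by continuity from
  below.\<close>

lemma submodular_tail_union_le:
  assumes "sigma_algebra J B" and "increasing B \<phi>" and "submodular B \<phi>"
    and "continuous_from_above B \<phi>"
    and Y: "range Y \<subseteq> B"
    and dist: "\<And>k. bjorner_dist \<phi> (Y k) (Y (Suc k)) \<le> (1/2) ^ k"
  shows "\<phi> (\<Union>i. Y (k + i)) \<le> \<phi> (Y k) + 2 * (1/2) ^ k"
proof -
  interpret sigma_algebra J B by fact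
  define A where "A m = (\<Union>i\<le>m. Y (k + i))" for m
  have "range A \<subseteq> B"
    using Y by (auto simp: A_def intro!: finite_UN)
  moreover have "incseq A"
    unfolding A_def by (intro monoI UN_mono) auto
  ultimately have "(\<lambda>m. \<phi> (A m)) \<longlonglongrightarrow> \<phi> (\<Union>m. A m)"
    using submodular_continuous_from_below assms(1-4) by blast
  moreover have "(\<Union>m. A m) = (\<Union>i. Y (k + i))"
    by (auto simp: A_def)
  ultimately have "(\<lambda>m. \<phi> (A m)) \<longlonglongrightarrow> \<phi> (\<Union>i. Y (k + i))"
    by simp
  moreover have "\<phi> (A m) \<le> \<phi> (Y k) + 2 * (1/2) ^ k" for m
  proof -
    have "\<phi> (A m) \<le> \<phi> (Y k) + (\<Sum>i<m. bjorner_dist \<phi> (Y (k + i)) (Y (Suc (k + i))))"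
      using submodular_UN_le_sum_bjorner_dist[OF assms(1-3), of "\<lambda>i. Y (k + i)" m] Y
      by (auto simp: A_def)
    also have "(\<Sum>i<m. bjorner_dist \<phi> (Y (k + i)) (Y (Suc (k + i)))) \<le> (\<Sum>i<m. (1/2) ^ (k + i))"
      by (intro sum_mono dist)
    also have "\<dots> = (1/2) ^ k * (\<Sum>i<m. (1/2) ^ i)"
      by (simp add: power_add sum_distrib_left)
    \<comment> \<open>The finite geometric sum equals \<open>2 - 2 * (1/2) ^ m\<close>.\<close>
    also have "\<dots> \<le> (1/2) ^ k * 2"
      by (intro mult_left_mono) (simp_all add: sum_gp_strict)
    finally show ?thesis by simp
  qed
  ultimately show ?thesis
    by (intro LIMSEQ_le_const2) auto
qed

lemma bjorner_dist_limsup_tendsto_0: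
  assumes "sigma_algebra J B" and inc: "increasing B \<phi>" and sub: "submodular B \<phi>"
    and cont: "continuous_from_above B \<phi>"
    and Y: "range Y \<subseteq> B"
    and dist: "\<And>k. bjorner_dist \<phi> (Y k) (Y (Suc k)) \<le> (1/2) ^ k"
  shows "(\<lambda>k. bjorner_dist \<phi> (Y k) (\<Inter>k. \<Union>i. Y (k + i))) \<longlonglongrightarrow> 0"
proof -
  interpret sigma_algebra J B by fact
  define U where "U k = (\<Union>i. Y (k + i))" for k
  define Z where "Z = (\<Inter>k. U k)"
  have YB: "Y k \<in> B" for k
    using Y by auto
  have UB: "U k \<in> B" for k
    unfolding U_def using YB by (intro countable_UN) auto
  have ZB: "Z \<in> B"
    unfolding Z_def using UB by (intro countable_INT) auto
  have "decseq U"
  proof (rule decseq_SucI)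
    fix k
    have "Y (Suc k + i) \<subseteq> (\<Union>i. Y (k + i))" for i
      using UN_upper[of "Suc i" UNIV "\<lambda>i. Y (k + i)"] by simp
    then show "U (Suc k) \<subseteq> U k"
      unfolding U_def by blast
  qed
  then have UZ: "(\<lambda>k. \<phi> (U k)) \<longlonglongrightarrow> \<phi> Z"
    using cont UB unfolding continuous_from_above_def Z_def by blast
  \<comment> \<open>Replacing \<open>Y k \<union> Z\<close> by the larger \<open>U k\<close> splits
    the distance into \<open>\<phi> (U k) - \<phi> Z\<close> and
    \<open>\<phi> (U k) - \<phi> (Y k)\<close>; the tail bound controls the latter.\<close>
  have "bjorner_dist \<phi> (Y k) Z \<le> \<phi> (U k) - \<phi> Z + 2 * (1/2) ^ k" for k
  proof -
    have "Y k \<subseteq> U k"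
      unfolding U_def by (metis UNIV_I UN_upper add_0_right)
    then have "\<phi> (Y k \<union> Z) \<le> \<phi> (U k)"
      using YB ZB UB by (intro increasingD[OF inc]) (auto simp: Z_def)
    moreover have "\<phi> (U k) \<le> \<phi> (Y k) + 2 * (1/2) ^ k"
      unfolding U_def by (rule submodular_tail_union_le[OF assms])
    ultimately show ?thesis
      by (simp add: bjorner_dist_def)
  qed
  moreover have "0 \<le> bjorner_dist \<phi> (Y k) Z" for k
    using pseudometric_on_bjorner_dist[OF assms(1-3)] YB ZB
    unfolding pseudometric_on_def by blast
  moreover have upper: "(\<lambda>k. \<phi> (U k) - \<phi> Z + 2 * (1/2) ^ k) \<longlonglongrightarrow> \<phi> Z - \<phi> Z + 2 * 0"
    by (intro tendsto_intros UZ LIMSEQ_power_zero) simp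
  ultimately have "(\<lambda>k. bjorner_dist \<phi> (Y k) Z) \<longlonglongrightarrow> 0"
    by (intro tendsto_sandwich[OF _ _ tendsto_const upper[simplified]] always_eventually allI)
  then show ?thesis
    by (simp add: Z_def U_def)
qed

theorem mainTheorem16:
  fixes J :: "'a set" and B :: "'a set set" and \<phi> :: "'a set \<Rightarrow> real"
  assumes "sigma_algebra J B"
    and "increasing B \<phi>"
    and "submodular B \<phi>"
    and "continuous_from_above B \<phi>"
  shows "pm_complete B (bjorner_dist \<phi>)"
  unfolding pm_complete_def
proof (intro allI impI)
  interpret sigma_algebra J B by fact
  let ?d = "bjorner_dist \<phi>"
  fix X
  assume "pm_Cauchy B ?d X"
  then have XB: "\<And>n. X n \<in> B"
    and Cauchy: "\<And>\<epsilon>. \<epsilon> > 0 \<Longrightarrow> \<exists>N. \<forall>m\<ge>N. \<forall>n\<ge>N. ?d (X m) (X n) < \<epsilon>"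
    unfolding pm_Cauchy_def by auto
  have "\<forall>k. \<exists>N. \<forall>m\<ge>N. \<forall>n\<ge>N. ?d (X m) (X n) < (1/2) ^ k"
    by (intro allI Cauchy) simp
  then obtain f where f: "\<And>k m n. m \<ge> f k \<Longrightarrow> n \<ge> f k \<Longrightarrow> ?d (X m) (X n) < (1/2) ^ k"
    by metis
  \<comment> \<open>Partial sums put both \<open>r k\<close> and \<open>r (Suc k)\<close> beyond the
    threshold \<open>f k\<close>, whether or not \<open>f\<close> is monotone. Indices may repeat,
    which is harmless for the distance bound.\<close>
  define r where "r k = (\<Sum>j\<le>k. f j)" for k
  have r: "f k \<le> r k" "f k \<le> r (Suc k)" for k
    unfolding r_def by (intro member_le_sum; simp)+
  define Y where "Y k = X (r k)" for k
  define Z where "Z = (\<Inter>k. \<Union>i. Y (k + i))"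
  have YB: "range Y \<subseteq> B"
    using XB by (auto simp: Y_def)
  then have ZB: "Z \<in> B"
    unfolding Z_def by (intro countable_INT countable_UN image_subsetI) auto
  have "?d (Y k) (Y (Suc k)) \<le> (1/2) ^ k" for k
    unfolding Y_def using f[OF r] by (rule less_imp_le)
  then have YZ: "(\<lambda>k. ?d (Y k) Z) \<longlonglongrightarrow> 0"
    unfolding Z_def by (intro bjorner_dist_limsup_tendsto_0[OF assms YB])
  have pm: "pseudometric_on B ?d"
    by (rule pseudometric_on_bjorner_dist[OF assms(1-3)])
  have "(\<lambda>n. ?d (X n) Z) \<longlonglongrightarrow> 0"
  proof (rule LIMSEQ_I)
    fix e :: real
    assume "0 < e"
    have "(\<lambda>k. (1/2) ^ k + ?d (Y k) Z) \<longlonglongrightarrow> 0 + 0"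
      by (intro tendsto_add YZ LIMSEQ_power_zero) simp
    then have "\<forall>\<^sub>F k in sequentially. (1/2) ^ k + ?d (Y k) Z < e"
      using \<open>0 < e\<close> by (auto dest: order_tendstoD(2))
    then obtain k where k: "(1/2) ^ k + ?d (Y k) Z < e"
      by (auto simp: eventually_sequentially)
    \<comment> \<open>A single good \<open>k\<close> suffices: beyond \<open>f k\<close> every
      \<open>X n\<close> is close to \<open>Y k\<close>, which is close to \<open>Z\<close>.\<close>
    have "norm (?d (X n) Z - 0) < e" if "n \<ge> f k" for n
    proof -
      have "?d (X n) Z \<le> ?d (X n) (Y k) + ?d (Y k) Z"
        using pm XB YB ZB unfolding pseudometric_on_def by blast
      moreover have "?d (X n) (Y k) < (1/2) ^ k"
        unfolding Y_def using that r(1) by (rule f)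
      moreover have "0 \<le> ?d (X n) Z"
        using pm XB ZB unfolding pseudometric_on_def by blast
      ultimately show ?thesis
        using k by simp
    qed
    then show "\<exists>N. \<forall>n\<ge>N. norm (?d (X n) Z - 0) < e"
      by blast
  qed
  with ZB show "\<exists>z\<in>B. (\<lambda>n. ?d (X n) z) \<longlonglongrightarrow> 0"
    by blast
qed

end
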